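(* Let $d\in\mathbb{N}$ and $M(t)=t\log(e+t)$, $t>0$. There is a constant $c_d$ depending only on $d$ such that for every measurable $f$ on $\mathbb{R}^d\setminus\mathbb{B}^d$, $$\int_{\mathbb{R}^d\setminus\mathbb{B}^d}|f(s)|\log(1+|s|)ds\leq c_d\|Vf\|_{L_M(\mathbb{B}^d)}.$$
   Context: $\mathbb{B}^d$ is the unit ball in $\mathbb{R}^d$; all spaces carry Lebesgue measure. $(Vf)(t)=|t|^{-2d}f(t/|t|^2)$. For a measurable set $\Omega$, $\|g\|_{L_M(\Omega)}=\inf\{\lambda>0:\int_\Omega M(|g|/\lambda)\le1\}$. *)

theory Defs
  imports "HOL-Analysis.Analysis"
begin

text \<open>Young function M(t) = t log(e + t).\<close>
definition Mlog :: "real \<Rightarrow> real" where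
  "Mlog t = t * ln (exp 1 + t)"

text \<open>Inversion operator (V f)(t) = |t|^(-2d) f(t / |t|^2), d = DIM('a).\<close>
definition Vop :: "('a::euclidean_space \<Rightarrow> real) \<Rightarrow> 'a \<Rightarrow> real" where
  "Vop f t = norm t powr (- 2 * real DIM('a)) * f (t /\<^sub>R (norm t)\<^sup>2)"

text \<open>Luxemburg norm in L_M(Omega) w.r.t. Lebesgue measure; value in ennreal,
  the infimum of the empty set being \<infinity>.\<close>
definition luxemburg_norm ::
  "(real \<Rightarrow> real) \<Rightarrow> 'a::euclidean_space set \<Rightarrow> ('a \<Rightarrow> real) \<Rightarrow> ennreal" where
  "luxemburg_norm M \<Omega> g =
     (INF r \<in> {r::real. r > 0 \<and>
         (\<integral>\<^sup>+ x \<in> \<Omega>. ennreal (M (\<bar>g x\<bar> / r)) \<partial>lebesgue) \<le> 1}. ennreal r)"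

end

theory Submission
  imports Defs
begin

(* The inversion t |-> t / |t|^2 maps the punctured unit ball B \ {0} onto the exterior of B,
   with Jacobian of modulus |t|^(-2d); hence the left-hand side equals the integral over B of
   |Vf(t)| log(1 + 1/|t|). If r > 0 satisfies int_B M(|Vf|/r) <= 1, the Young-type inequality
   a b <= 4 (M(a) + exp(b/2)), applied with a = |Vf(t)|/r and b = log(1 + 1/|t|), bounds that
   integral by 4 r (1 + int_B (1 + 1/|t|)^(1/2) dt). The last integral is finite in every
   dimension because |t|^(-p) is integrable near 0 for p < d, and taking the infimum over such r
   yields the Luxemburg norm. *)

(* The change-of-variables theorem of HOL-Analysis is stated for real^'n with 'n a finite
   wellorder; indexing coordinates by the basis transports any Euclidean space isometrically
   onto such a space. *)
typedef (overloaded) ('a::euclidean_space) basis_index = "Basis :: 'a set"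
  using nonempty_Basis by blast

instance basis_index :: (euclidean_space) finite
proof
  have "UNIV = Abs_basis_index ` (Basis :: 'a set)"
    using type_definition.Abs_image[OF type_definition_basis_index] by metis
  then show "finite (UNIV :: 'a basis_index set)"
    by (metis finite_Basis finite_imageI)
qed

instantiation basis_index :: (euclidean_space) linorder
begin

definition less_eq_basis_index :: "'a basis_index \<Rightarrow> 'a basis_index \<Rightarrow> bool"
  where "less_eq_basis_index i j \<longleftrightarrow> to_nat i \<le> to_nat j"

definition less_basis_index :: "'a basis_index \<Rightarrow> 'a basis_index \<Rightarrow> bool"
  where "less_basis_index i j \<longleftrightarrow> to_nat i < to_nat j"

instance
  by standard (auto simp: less_eq_basis_index_def less_basis_index_def)

end

instance basis_index :: (euclidean_space) wellorder
proof
  fix P :: "'a basis_index \<Rightarrow> bool" and a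
  assume step: "\<And>i. (\<And>j. j < i \<Longrightarrow> P j) \<Longrightarrow> P i"
  show "P a"
    by (induction a rule: measure_induct_rule[of to_nat]) (rule step, simp add: less_basis_index_def)
qed

definition of_coords :: "real^('a::euclidean_space basis_index) \<Rightarrow> 'a"
  where "of_coords v = (\<Sum>i\<in>UNIV. (v $ i) *\<^sub>R Rep_basis_index i)"

definition coords :: "'a::euclidean_space \<Rightarrow> real^('a basis_index)"
  where "coords x = (\<chi> i. x \<bullet> Rep_basis_index i)"

lemma range_Rep_basis_index: "range Rep_basis_index = (Basis :: 'a::euclidean_space set)"
  using type_definition.Rep_range[OF type_definition_basis_index] by metis

lemma sum_basis_index:
  "(\<Sum>i\<in>UNIV. g (Rep_basis_index i)) = (\<Sum>b\<in>(Basis::'a::euclidean_space set). g b)"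
  by (subst range_Rep_basis_index[symmetric], subst sum.reindex)
     (auto simp: inj_def Rep_basis_index_inject)

lemma prod_basis_index:
  "(\<Prod>i\<in>UNIV. g (Rep_basis_index i)) = (\<Prod>b\<in>(Basis::'a::euclidean_space set). g b)"
  by (subst range_Rep_basis_index[symmetric], subst prod.reindex)
     (auto simp: inj_def Rep_basis_index_inject)

lemma card_basis_index: "CARD('a::euclidean_space basis_index) = DIM('a)"
proof -
  have "CARD('a basis_index) = card (range (Rep_basis_index :: 'a basis_index \<Rightarrow> 'a))"
    by (simp add: card_image inj_def Rep_basis_index_inject)
  then show ?thesis by (simp add: range_Rep_basis_index)
qed

lemma Rep_basis_index_in_Basis: "Rep_basis_index i \<in> Basis"
  using Rep_basis_index by blast

lemma inner_of_coords_Rep: "of_coords v \<bullet> Rep_basis_index j = v $ j"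
proof -
  have "of_coords v \<bullet> Rep_basis_index j
      = (\<Sum>i\<in>UNIV. v $ i * (Rep_basis_index i \<bullet> Rep_basis_index j))"
    by (simp add: of_coords_def inner_sum_left)
  also have "\<dots> = (\<Sum>i\<in>UNIV. if i = j then v $ j else 0)"
    by (intro sum.cong) (auto simp: inner_Basis Rep_basis_index_in_Basis Rep_basis_index_inject)
  finally show ?thesis by simp
qed

lemma coords_of_coords [simp]: "coords (of_coords v) = v"
  by (simp add: coords_def inner_of_coords_Rep vec_eq_iff)

lemma linear_of_coords: "linear of_coords"
  unfolding of_coords_def
  by (rule linearI) (simp_all add: scaleR_add_left sum.distrib scaleR_sum_right)

lemma norm_coords [simp]: "norm (coords x) = norm x"
proof -
  have "coords x \<bullet> coords x = x \<bullet> x"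
    using sum_basis_index[of "\<lambda>b. (x \<bullet> b) * (x \<bullet> b)"]
    by (simp add: coords_def inner_vec_def euclidean_inner[of x x])
  then show ?thesis by (simp add: norm_eq_sqrt_inner)
qed

lemma norm_of_coords [simp]: "norm (of_coords v) = norm v"
  by (metis norm_coords coords_of_coords)

lemma borel_measurable_of_coords [measurable]: "of_coords \<in> borel_measurable borel"
  by (intro borel_measurable_continuous_onI linear_continuous_on)
     (simp add: linear_of_coords linear_conv_bounded_linear[symmetric])

lemma vimage_of_coords_box: "of_coords -` box l u = box (coords l) (coords u)"
proof (rule set_eqI)
  fix v
  have "of_coords v \<in> box l u \<longleftrightarrow>
      (\<forall>i. l \<bullet> Rep_basis_index i < v $ i \<and> v $ i < u \<bullet> Rep_basis_index i)"
    unfolding mem_box inner_of_coords_Rep[symmetric] by (metis range_Rep_basis_index rangeE rangeI)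
  moreover have "v \<in> box (coords l) (coords u) \<longleftrightarrow>
      (\<forall>i. l \<bullet> Rep_basis_index i < v $ i \<and> v $ i < u \<bullet> Rep_basis_index i)"
    unfolding mem_box_cart coords_def vec_lambda_beta ..
  ultimately show "v \<in> of_coords -` box l u \<longleftrightarrow> v \<in> box (coords l) (coords u)"
    unfolding vimage_eq by blast
qed

lemma lborel_eq_distr_of_coords:
  "lborel = distr lborel borel (of_coords :: real^('a::euclidean_space basis_index) \<Rightarrow> 'a)"
proof (rule lborel_eqI)
  fix l u :: 'a
  assume le: "\<And>b. b \<in> Basis \<Longrightarrow> l \<bullet> b \<le> u \<bullet> b"
  have "emeasure (distr lborel borel (of_coords :: real^('a basis_index) \<Rightarrow> 'a)) (box l u)
      = emeasure lborel (box (coords l) (coords u))"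
    by (simp add: emeasure_distr vimage_of_coords_box)
  also have "\<dots> = (\<Prod>k\<in>(Basis :: (real^('a basis_index)) set). (coords u - coords l) \<bullet> k)"
    using le by (auto simp: emeasure_lborel_box_eq Basis_vec_def coords_def inner_axis
        Rep_basis_index_in_Basis inner_diff_left)
  also have "\<dots> = (\<Prod>i\<in>UNIV. (u - l) \<bullet> Rep_basis_index i)"
    by (simp add: Basis_vec_def UNION_singleton_eq_range prod.reindex axis_eq_axis inj_on_def
        inner_axis coords_def inner_diff_left)
  also have "\<dots> = (\<Prod>b\<in>Basis. (u - l) \<bullet> b)"
    using prod_basis_index[of "\<lambda>b. (u - l) \<bullet> b"] by simp
  finally show "emeasure (distr lborel borel (of_coords :: real^('a basis_index) \<Rightarrow> 'a)) (box l u)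
      = (\<Prod>b\<in>Basis. (u - l) \<bullet> b)" .
qed simp

lemma distr_lebesgue_of_coords:
  "distr lebesgue lborel (of_coords :: real^('a::euclidean_space basis_index) \<Rightarrow> 'a) = lborel"
proof -
  have "distr lebesgue lborel (of_coords :: real^('a basis_index) \<Rightarrow> 'a) = distr lborel borel of_coords"
    by (simp add: distr_completion) (rule distr_cong, auto)
  then show ?thesis
    by (metis lborel_eq_distr_of_coords)
qed

lemma measurable_of_coords_lebesgue:
  "of_coords \<in> lebesgue \<rightarrow>\<^sub>M (lebesgue :: 'a::euclidean_space measure)"
proof -
  have "null_sets lborel = null_sets (distr lebesgue lborel (of_coords :: real^('a basis_index) \<Rightarrow> 'a))"
    by (simp add: distr_lebesgue_of_coords)
  then show ?thesis
    by (simp add: completion.measurable_completion2 measurable_completion)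
qed

lemma lebesgue_eq_distr_of_coords:
  "(lebesgue :: 'a::euclidean_space measure)
     = distr lebesgue lebesgue (of_coords :: real^('a basis_index) \<Rightarrow> 'a)"
proof -
  have "(lebesgue :: 'a measure)
      = completion (distr lebesgue lborel (of_coords :: real^('a basis_index) \<Rightarrow> 'a))"
    by (simp add: distr_lebesgue_of_coords)
  also have "\<dots> = distr lebesgue (completion lborel) of_coords"
    by (rule completion.completion_distr_eq)
       (auto simp: distr_lebesgue_of_coords measurable_completion)
  finally show ?thesis by simp
qed

lemma nn_integral_lebesgue_of_coords:
  fixes g :: "'a::euclidean_space \<Rightarrow> ennreal"
  assumes "g \<in> borel_measurable lebesgue"
  shows "(\<integral>\<^sup>+x. g x \<partial>lebesgue) = (\<integral>\<^sup>+v. g (of_coords v) \<partial>(lebesgue :: (real^('a basis_index)) measure))"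
  using nn_integral_distr[OF measurable_of_coords_lebesgue, of g] assms
  by (simp flip: lebesgue_eq_distr_of_coords)

lemma set_nn_integral_lebesgue_of_coords:
  fixes h :: "'a::euclidean_space \<Rightarrow> real"
  assumes "A \<in> sets lebesgue" "h \<in> borel_measurable lebesgue"
  shows "(\<integral>\<^sup>+x\<in>A. ennreal (h x) \<partial>lebesgue)
       = (\<integral>\<^sup>+v\<in>of_coords -` A. ennreal (h (of_coords v)) \<partial>(lebesgue :: (real^('a basis_index)) measure))"
proof -
  have "(\<lambda>x. ennreal (h x) * indicator A x) \<in> borel_measurable lebesgue"
    using assms by measurable
  then show ?thesis
    by (simp add: nn_integral_lebesgue_of_coords indicator_vimage)
qed

definition inversion :: "'a::real_normed_vector \<Rightarrow> 'a"
  where "inversion x = x /\<^sub>R (norm x)\<^sup>2"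

lemma inversion_0 [simp]: "inversion 0 = 0"
  by (simp add: inversion_def)

lemma norm_inversion [simp]: "norm (inversion x) = inverse (norm x)"
  by (cases "x = 0") (simp_all add: inversion_def power2_eq_square)

lemma inversion_inversion [simp]: "inversion (inversion x) = x"
  by (cases "x = 0") (simp_all add: inversion_def power2_eq_square field_simps)

lemma inversion_eq_0_iff [simp]: "inversion x = 0 \<longleftrightarrow> x = 0"
  by (metis inversion_0 inversion_inversion)

lemma image_inversion: "inversion ` S = inversion -` S"
  by (auto simp: image_iff) (metis inversion_inversion)

lemma of_coords_inversion: "of_coords (inversion v) = inversion (of_coords v)"
  by (simp add: inversion_def linear_cmul[OF linear_of_coords])

lemma Vop_eq_inversion: "Vop f t = norm t powr (- 2 * real DIM('a)) * f (inversion t)"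
  for f :: "'a::euclidean_space \<Rightarrow> real"
  by (simp add: Vop_def inversion_def)

definition householder :: "'a::real_inner \<Rightarrow> 'a \<Rightarrow> 'a"
  where "householder x h = h - (2 * (x \<bullet> h) / (norm x)\<^sup>2) *\<^sub>R x"

lemma orthogonal_transformation_householder:
  fixes x :: "'a::euclidean_space"
  assumes "x \<noteq> 0"
  shows "orthogonal_transformation (householder x)"
  unfolding orthogonal_transformation
proof
  show "linear (householder x)"
    by (rule linearI)
       (simp_all add: householder_def inner_add_right add_divide_distrib scaleR_add_left
         scaleR_diff_right)
  show "\<forall>v. norm (householder x v) = norm v"
  proof
    fix v
    define c where "c = 2 * (x \<bullet> v) / (norm x)\<^sup>2"
    have "householder x v \<bullet> householder x v = v \<bullet> v - 2 * c * (x \<bullet> v) + c * c * (x \<bullet> x)"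
      unfolding householder_def c_def[symmetric]
      by (simp add: inner_diff_left inner_diff_right inner_commute algebra_simps)
    also have "\<dots> = v \<bullet> v"
      using assms by (simp add: c_def power2_norm_eq_inner field_simps)
    finally show "norm (householder x v) = norm v"
      by (simp add: norm_eq_sqrt_inner)
  qed
qed

lemma has_derivative_inversion:
  fixes x :: "'a::real_inner"
  assumes "x \<noteq> 0"
  shows "(inversion has_derivative (\<lambda>h. householder x h /\<^sub>R (norm x)\<^sup>2)) (at x)"
proof -
  have "((\<lambda>x. inverse (x \<bullet> x) *\<^sub>R x) has_derivative
      (\<lambda>h. householder x h /\<^sub>R (norm x)\<^sup>2)) (at x)"
    using assms
    by (auto intro!: derivative_eq_intros ext)
       (simp add: householder_def power2_norm_eq_inner[symmetric] inner_commute field_simps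
         power2_eq_square)
  then show ?thesis
    by (simp add: inversion_def[abs_def] power2_norm_eq_inner divide_inverse_commute)
qed

lemma abs_det_derivative_inversion:
  fixes x :: "real^'n"
  assumes "x \<noteq> 0"
  shows "\<bar>det (matrix (\<lambda>h. householder x h /\<^sub>R (norm x)\<^sup>2))\<bar> = norm x powr (- 2 * real CARD('n))"
proof -
  have orth: "orthogonal_transformation (householder x)"
    using assms by (rule orthogonal_transformation_householder)
  then have "linear (householder x)"
    by (simp add: orthogonal_transformation)
  then have "matrix ((*\<^sub>R) (inverse ((norm x)\<^sup>2)) \<circ> householder x)
      = matrix ((*\<^sub>R) (inverse ((norm x)\<^sup>2))) ** matrix (householder x)"
    by (rule matrix_compose) (simp add: linear_scaleR)
  then have "\<bar>det (matrix (\<lambda>h. householder x h /\<^sub>R (norm x)\<^sup>2))\<bar>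
      = \<bar>inverse ((norm x)\<^sup>2) ^ CARD('n)\<bar>"
    using orth by (simp add: o_def det_mul abs_mult)
  also have "\<dots> = inverse (norm x ^ (2 * CARD('n)))"
    by (simp add: power_inverse power_mult)
  also have "\<dots> = norm x powr (- 2 * real CARD('n))"
  proof -
    have "norm x ^ (2 * CARD('n)) = norm x powr real (2 * CARD('n))"
      using assms by (intro powr_realpow[symmetric]) simp
    then show ?thesis
      by (simp add: powr_minus)
  qed
  finally show ?thesis .
qed

lemma sets_lebesgue_image_inversion:
  fixes S :: "'a::euclidean_space set"
  assumes "S \<in> sets lebesgue" "0 \<notin> S"
  shows "inversion ` S \<in> sets lebesgue"
proof -
  have "inversion differentiable_on S"
    using assms(2) unfolding differentiable_on_def
    by (metis differentiable_at_withinI differentiable_def has_derivative_inversion)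
  then show ?thesis
    using assms(1) by (intro differentiable_image_in_sets_lebesgue) auto
qed

lemma borel_measurable_comp_inversion:
  fixes h :: "'a::euclidean_space \<Rightarrow> real"
  assumes "h \<in> borel_measurable lebesgue"
  shows "(\<lambda>t. h (inversion t)) \<in> borel_measurable lebesgue"
  unfolding borel_measurable_lebesgue_preimage_borel
proof (intro allI impI)
  fix U :: "real set"
  assume "U \<in> sets borel"
  then have A: "{s. h s \<in> U} \<in> sets lebesgue"
    using assms by (auto simp: borel_measurable_lebesgue_preimage_borel)
  then have "inversion ` ({s. h s \<in> U} - {0}) \<union> ({s. h s \<in> U} \<inter> {0}) \<in> sets lebesgue"
    by (intro sets.Un sets_lebesgue_image_inversion) auto
  moreover have "{t. h (inversion t) \<in> U} = inversion ` ({s. h s \<in> U} - {0}) \<union> ({s. h s \<in> U} \<inter> {0})"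
    by (auto simp: image_inversion)
  ultimately show "{t. h (inversion t) \<in> U} \<in> sets lebesgue"
    by simp
qed

lemma has_integral_change_of_variables_nonneg:
  fixes h :: "real^'n::{finite,wellorder} \<Rightarrow> real" and g :: "real^'n::_ \<Rightarrow> real^'n::_"
  assumes S: "S \<in> sets lebesgue"
    and der: "\<And>x. x \<in> S \<Longrightarrow> (g has_derivative g' x) (at x within S)"
    and inj: "inj_on g S"
    and h0: "\<And>y. y \<in> g ` S \<Longrightarrow> 0 \<le> h y"
  shows "((\<lambda>x. \<bar>det (matrix (g' x))\<bar> * h (g x)) has_integral r) S \<longleftrightarrow> (h has_integral r) (g ` S)"
proof -
  let ?J = "\<lambda>x. \<bar>det (matrix (g' x))\<bar> * h (g x)"
  have J0: "0 \<le> ?J x" if "x \<in> S" for x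
    using h0 that by simp
  have "(?J has_integral r) S \<longleftrightarrow> ?J absolutely_integrable_on S \<and> integral S ?J = r"
    using absolutely_integrable_on_iff_nonneg[of S ?J] J0 has_integral_integrable_integral by blast
  also have "\<dots> \<longleftrightarrow> (\<lambda>x. vec (?J x) :: real^1) absolutely_integrable_on S
      \<and> integral S (\<lambda>x. vec (?J x) :: real^1) = vec r"
    by (simp add: absolutely_integrable_on_1_iff integral_on_1_eq vec_inj)
  also have "\<dots> \<longleftrightarrow> (\<lambda>y. vec (h y) :: real^1) absolutely_integrable_on g ` S
      \<and> integral (g ` S) (\<lambda>y. vec (h y) :: real^1) = vec r"
    using has_absolute_integral_change_of_variables[OF S der inj, of "\<lambda>y. vec (h y)" "vec r"]
    by (simp only: vec_scaleR[symmetric]) blast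
  also have "\<dots> \<longleftrightarrow> h absolutely_integrable_on g ` S \<and> integral (g ` S) h = r"
    by (simp add: absolutely_integrable_on_1_iff integral_on_1_eq vec_inj)
  also have "\<dots> \<longleftrightarrow> (h has_integral r) (g ` S)"
    using absolutely_integrable_on_iff_nonneg[of "g ` S" h] h0 has_integral_integrable_integral
    by blast
  finally show ?thesis .
qed

lemma nn_integral_lebesgue_eq_if_has_integral_iff:
  fixes H J :: "'a::euclidean_space \<Rightarrow> real"
  assumes "H \<in> borel_measurable lebesgue" "\<And>x. 0 \<le> H x"
    and "J \<in> borel_measurable lebesgue" "\<And>x. 0 \<le> J x"
    and has_integral_iff: "\<And>r. (H has_integral r) UNIV \<longleftrightarrow> (J has_integral r) UNIV"
  shows "(\<integral>\<^sup>+x. ennreal (H x) \<partial>lebesgue) = (\<integral>\<^sup>+x. ennreal (J x) \<partial>lebesgue)"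
proof -
  have eq: "(\<integral>\<^sup>+x. ennreal (H x) \<partial>lebesgue) = ennreal r \<longleftrightarrow> (\<integral>\<^sup>+x. ennreal (J x) \<partial>lebesgue) = ennreal r"
    if "0 \<le> r" for r
    using has_integral_iff_nn_integral_lebesgue[of H r] has_integral_iff_nn_integral_lebesgue[of J r]
      has_integral_iff assms that by auto
  show ?thesis
  proof (cases "(\<integral>\<^sup>+x. ennreal (H x) \<partial>lebesgue)" rule: ennreal_cases)
    case (real r)
    then show ?thesis
      using eq by simp
  next
    case top
    then show ?thesis
      using eq by (cases "(\<integral>\<^sup>+x. ennreal (J x) \<partial>lebesgue)" rule: ennreal_cases) auto
  qed
qed

lemma nn_integral_change_of_variables:
  fixes h :: "real^'n::{finite,wellorder} \<Rightarrow> real" and g :: "real^'n::_ \<Rightarrow> real^'n::_"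
  assumes S: "S \<in> sets lebesgue"
    and der: "\<And>x. x \<in> S \<Longrightarrow> (g has_derivative g' x) (at x within S)"
    and inj: "inj_on g S"
    and h0: "\<And>y. 0 \<le> h y"
    and hm: "h \<in> borel_measurable lebesgue"
    and hgm: "(\<lambda>x. h (g x)) \<in> borel_measurable (lebesgue_on S)"
  shows "(\<integral>\<^sup>+y\<in>g ` S. ennreal (h y) \<partial>lebesgue)
       = (\<integral>\<^sup>+x\<in>S. ennreal (\<bar>det (matrix (g' x))\<bar> * h (g x)) \<partial>lebesgue)"
proof -
  define H where "H y = (if y \<in> g ` S then h y else 0)" for y
  define J where "J x = (if x \<in> S then \<bar>det (matrix (g' x))\<bar> * h (g x) else 0)" for x
  have "g differentiable_on S"
    using der by (meson differentiable_def differentiable_on_def)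
  then have "g ` S \<in> sets lebesgue"
    using S by (intro differentiable_image_in_sets_lebesgue) auto
  then have Hm: "H \<in> borel_measurable lebesgue"
    unfolding H_def[abs_def] using hm by measurable
  have "(\<lambda>x. \<bar>det (matrix (g' x))\<bar> * h (g x)) \<in> borel_measurable (lebesgue_on S)"
    using borel_measurable_det_Jacobian[OF S der] hgm by measurable
  then have Jm: "J \<in> borel_measurable lebesgue"
    using S unfolding J_def[abs_def] by (simp add: borel_measurable_if)
  have iff: "(H has_integral r) UNIV \<longleftrightarrow> (J has_integral r) UNIV" for r
    unfolding H_def[abs_def] J_def[abs_def] has_integral_restrict_UNIV
    using has_integral_change_of_variables_nonneg[OF S der inj] h0 by simp
  have "(\<integral>\<^sup>+y\<in>g ` S. ennreal (h y) \<partial>lebesgue) = (\<integral>\<^sup>+y. ennreal (H y) \<partial>lebesgue)"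
    by (intro nn_integral_cong) (simp add: H_def indicator_def)
  also have "\<dots> = (\<integral>\<^sup>+x. ennreal (J x) \<partial>lebesgue)"
    by (rule nn_integral_lebesgue_eq_if_has_integral_iff[OF Hm _ Jm _ iff]) (simp_all add: H_def J_def h0)
  also have "\<dots> = (\<integral>\<^sup>+x\<in>S. ennreal (\<bar>det (matrix (g' x))\<bar> * h (g x)) \<partial>lebesgue)"
    by (intro nn_integral_cong) (simp add: J_def indicator_def)
  finally show ?thesis .
qed

lemma nn_integral_inversion_cart:
  fixes h :: "real^'n::{finite,wellorder} \<Rightarrow> real"
  assumes S: "S \<in> sets lebesgue" "0 \<notin> S"
    and h0: "\<And>y. 0 \<le> h y"
    and hm: "h \<in> borel_measurable lebesgue"
  shows "(\<integral>\<^sup>+y\<in>inversion ` S. ennreal (h y) \<partial>lebesgue)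
       = (\<integral>\<^sup>+x\<in>S. ennreal (norm x powr (- 2 * real CARD('n)) * h (inversion x)) \<partial>lebesgue)"
proof -
  have der: "(inversion has_derivative (\<lambda>k. householder x k /\<^sub>R (norm x)\<^sup>2)) (at x within S)"
    if "x \<in> S" for x
    using that S(2) by (metis has_derivative_at_withinI has_derivative_inversion)
  have inj: "inj_on inversion S"
    by (metis inj_on_inverseI inversion_inversion)
  have hgm: "(\<lambda>x. h (inversion x)) \<in> borel_measurable (lebesgue_on S)"
    using hm by (intro measurable_restrict_space1 borel_measurable_comp_inversion)
  have "(\<integral>\<^sup>+y\<in>inversion ` S. ennreal (h y) \<partial>lebesgue)
      = (\<integral>\<^sup>+x\<in>S. ennreal (\<bar>det (matrix (\<lambda>k. householder x k /\<^sub>R (norm x)\<^sup>2))\<bar>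
          * h (inversion x)) \<partial>lebesgue)"
    by (rule nn_integral_change_of_variables[OF S(1) der inj h0 hm hgm])
  also have "\<dots> = (\<integral>\<^sup>+x\<in>S. ennreal (norm x powr (- 2 * real CARD('n)) * h (inversion x)) \<partial>lebesgue)"
  proof (intro set_nn_integral_cong refl)
    fix x
    assume "x \<in> space lebesgue \<inter> S"
    then have "x \<noteq> 0"
      using S(2) by auto
    then show "ennreal (\<bar>det (matrix (\<lambda>k. householder x k /\<^sub>R (norm x)\<^sup>2))\<bar> * h (inversion x))
        = ennreal (norm x powr (- 2 * real CARD('n)) * h (inversion x))"
      by (simp add: abs_det_derivative_inversion)
  qed
  finally show ?thesis .
qed

lemma nn_integral_inversion:
  fixes h :: "'a::euclidean_space \<Rightarrow> real"
  assumes S: "S \<in> sets lebesgue" "0 \<notin> S"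
    and h0: "\<And>y. 0 \<le> h y"
    and hm: "h \<in> borel_measurable lebesgue"
  shows "(\<integral>\<^sup>+y\<in>inversion ` S. ennreal (h y) \<partial>lebesgue)
       = (\<integral>\<^sup>+x\<in>S. ennreal (norm x powr (- 2 * real DIM('a)) * h (inversion x)) \<partial>lebesgue)"
proof -
  let ?S = "of_coords -` S :: (real^('a basis_index)) set"
  have "?S \<in> sets lebesgue"
    using measurable_sets[OF measurable_of_coords_lebesgue S(1)] by simp
  moreover have "0 \<notin> ?S"
    using S(2) by (simp add: of_coords_def)
  moreover have hm': "(\<lambda>v. h (of_coords v)) \<in> borel_measurable lebesgue"
    using measurable_compose[OF measurable_of_coords_lebesgue hm] by (simp add: comp_def)
  moreover have "of_coords -` inversion ` S = inversion ` ?S"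
    by (auto simp: image_inversion of_coords_inversion)
  ultimately have "(\<integral>\<^sup>+y\<in>inversion ` S. ennreal (h y) \<partial>lebesgue)
      = (\<integral>\<^sup>+v\<in>?S. ennreal (norm v powr (- 2 * real DIM('a)) * h (of_coords (inversion v))) \<partial>lebesgue)"
    using set_nn_integral_lebesgue_of_coords[OF sets_lebesgue_image_inversion[OF S] hm]
      nn_integral_inversion_cart[of ?S "\<lambda>v. h (of_coords v)"] h0
    by (simp add: card_basis_index)
  also have "\<dots> = (\<integral>\<^sup>+x\<in>S. ennreal (norm x powr (- 2 * real DIM('a)) * h (inversion x)) \<partial>lebesgue)"
  proof -
    have "(\<lambda>x::'a. norm x powr (- 2 * real DIM('a))) \<in> borel_measurable lebesgue"
      by (intro measurable_completion) measurable
    then have "(\<lambda>x. norm x powr (- 2 * real DIM('a)) * h (inversion x)) \<in> borel_measurable lebesgue"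
      using borel_measurable_comp_inversion[OF hm] by (rule borel_measurable_times)
    then show ?thesis
      using set_nn_integral_lebesgue_of_coords[OF S(1)] by (simp add: of_coords_inversion)
  qed
  finally show ?thesis .
qed

lemma image_inversion_punctured_cball: "inversion ` (cball 0 1 - {0}) = - ball (0::'a::real_normed_vector) 1"
proof -
  have "t \<in> inversion ` (cball 0 1 - {0}) \<longleftrightarrow> t \<in> - ball 0 1" for t :: 'a
    by (cases "t = 0") (auto simp: image_inversion inverse_le_1_iff)
  then show ?thesis by blast
qed

lemma nn_integral_exterior_ball_inversion:
  fixes F :: "'a::euclidean_space \<Rightarrow> real"
  assumes Fm: "F \<in> borel_measurable (lebesgue_on (- ball 0 1))" and F0: "\<And>s. 0 \<le> F s"
  shows "(\<integral>\<^sup>+s\<in>- ball 0 1. ennreal (F s) \<partial>lebesgue)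
       = (\<integral>\<^sup>+t\<in>ball 0 1. ennreal (norm t powr (- 2 * real DIM('a)) * F (inversion t)) \<partial>lebesgue)"
proof -
  define G where "G s = indicator (- ball 0 1) s * F s" for s :: 'a
  have Gm: "G \<in> borel_measurable lebesgue"
    using Fm unfolding G_def[abs_def] by (subst (asm) borel_measurable_restrict_space_iff) auto
  have G0: "0 \<le> G s" for s
    by (simp add: G_def F0)
  have "(\<integral>\<^sup>+s\<in>- ball 0 1. ennreal (F s) \<partial>lebesgue) = (\<integral>\<^sup>+s\<in>inversion ` (cball 0 1 - {0}). ennreal (G s) \<partial>lebesgue)"
    by (intro set_nn_integral_cong) (auto simp: image_inversion_punctured_cball G_def)
  also have "\<dots> = (\<integral>\<^sup>+t\<in>cball 0 1 - {0}. ennreal (norm t powr (- 2 * real DIM('a)) * G (inversion t)) \<partial>lebesgue)"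
    by (rule nn_integral_inversion[OF _ _ G0 Gm]) auto
  also have "\<dots> = (\<integral>\<^sup>+t\<in>ball 0 1. ennreal (norm t powr (- 2 * real DIM('a)) * F (inversion t)) \<partial>lebesgue)"
  proof (rule nn_integral_cong_AE)
    \<comment> \<open>The punctured closed ball and the open ball differ by the unit sphere and the origin,
      and the integrands vanish at the origin.\<close>
    have "sphere (0::'a) 1 \<in> null_sets lebesgue"
      using negligible_sphere negligible_iff_null_sets by blast
    then show "AE t in lebesgue.
        ennreal (norm t powr (- 2 * real DIM('a)) * G (inversion t)) * indicator (cball 0 1 - {0}) t
        = ennreal (norm t powr (- 2 * real DIM('a)) * F (inversion t)) * indicator (ball 0 1) t"
      by (rule AE_I') (auto simp: G_def indicator_def inverse_less_1_iff)
  qed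
  finally show ?thesis .
qed

(* At t = 0 both sides vanish, because 0 powr _ = 0. *)
lemma Vop_indicator_exterior:
  fixes f :: "'a::euclidean_space \<Rightarrow> real"
  assumes "t \<in> ball 0 1"
  shows "Vop (\<lambda>s. indicator (- ball 0 1) s * f s) t = Vop f t"
  using assms by (cases "t = 0") (auto simp: Vop_eq_inversion indicator_def inverse_less_1_iff)

lemma borel_measurable_Vop:
  fixes f :: "'a::euclidean_space \<Rightarrow> real"
  assumes "f \<in> borel_measurable (lebesgue_on (- ball 0 1))"
  shows "Vop f \<in> borel_measurable (lebesgue_on (ball 0 1))"
proof -
  define G where "G s = indicator (- ball 0 1) s * f s" for s :: 'a
  have "G \<in> borel_measurable lebesgue"
    using assms unfolding G_def[abs_def] by (subst (asm) borel_measurable_restrict_space_iff) auto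
  moreover have "(\<lambda>t::'a. norm t powr (- 2 * real DIM('a))) \<in> borel_measurable lebesgue"
    by (intro measurable_completion) measurable
  ultimately have "Vop G \<in> borel_measurable lebesgue"
    unfolding Vop_eq_inversion[abs_def] by (intro borel_measurable_times borel_measurable_comp_inversion)
  then have "Vop G \<in> borel_measurable (lebesgue_on (ball 0 1))"
    by (rule measurable_restrict_space1)
  then show ?thesis
    by (rule measurable_cong[THEN iffD1, rotated]) (simp add: G_def[abs_def] Vop_indicator_exterior)
qed

lemma nn_integral_exterior_ball_Vop:
  fixes f :: "'a::euclidean_space \<Rightarrow> real" and w :: "real \<Rightarrow> real"
  assumes f: "f \<in> borel_measurable (lebesgue_on (- ball 0 1))"
    and w: "w \<in> borel_measurable borel" "\<And>r. 0 \<le> r \<Longrightarrow> 0 \<le> w r"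
  shows "(\<integral>\<^sup>+s\<in>- ball 0 1. ennreal (\<bar>f s\<bar> * w (norm s)) \<partial>lebesgue)
       = (\<integral>\<^sup>+t\<in>ball 0 1. ennreal (\<bar>Vop f t\<bar> * w (inverse (norm t))) \<partial>lebesgue)"
proof -
  have "(\<lambda>s::'a. w (norm s)) \<in> borel_measurable lebesgue"
    by (rule measurable_completion, rule measurable_compose[OF _ w(1)]) simp
  then have "(\<lambda>s. w (norm s)) \<in> borel_measurable (lebesgue_on (- ball (0::'a) 1))"
    by (rule measurable_restrict_space1)
  with f have "(\<lambda>s. \<bar>f s\<bar> * w (norm s)) \<in> borel_measurable (lebesgue_on (- ball 0 1))"
    by (intro borel_measurable_times borel_measurable_abs)
  then have "(\<integral>\<^sup>+s\<in>- ball 0 1. ennreal (\<bar>f s\<bar> * w (norm s)) \<partial>lebesgue)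
      = (\<integral>\<^sup>+t\<in>ball 0 1. ennreal (norm t powr (- 2 * real DIM('a))
          * (\<bar>f (inversion t)\<bar> * w (norm (inversion t)))) \<partial>lebesgue)"
    by (rule nn_integral_exterior_ball_inversion) (simp add: w(2))
  also have "\<dots> = (\<integral>\<^sup>+t\<in>ball 0 1. ennreal (\<bar>Vop f t\<bar> * w (inverse (norm t))) \<partial>lebesgue)"
    by (intro set_nn_integral_cong) (auto simp: Vop_eq_inversion abs_mult mult.assoc)
  finally show ?thesis .
qed

lemma Mlog_nonneg: "0 \<le> t \<Longrightarrow> 0 \<le> Mlog t"
  unfolding Mlog_def
  by (intro mult_nonneg_nonneg) (auto intro!: ln_ge_zero simp: add_increasing2 order_trans[OF _ exp_ge_add_one_self])

lemma borel_measurable_Mlog [measurable]: "Mlog \<in> borel_measurable borel"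
  unfolding Mlog_def[abs_def] by measurable

lemma mult_le_Mlog_exp:
  fixes a b :: real
  assumes a: "0 \<le> a" and b: "0 \<le> b"
  shows "a * b \<le> 4 * (Mlog a + exp (b / 2))"
proof (cases "b / 4 \<le> ln (exp 1 + a)")
  case True
  then have "a * b \<le> a * (4 * ln (exp 1 + a))"
    using a by (intro mult_left_mono) auto
  also have "\<dots> \<le> 4 * (Mlog a + exp (b / 2))"
    by (simp add: Mlog_def)
  finally show ?thesis .
next
  case False
  then have "a \<le> exp (b / 4)"
    using a by (smt (verit) exp_gt_zero exp_less_mono exp_ln)
  moreover have "b \<le> 4 * exp (b / 4)"
    using exp_ge_add_one_self[of "b / 4"] by linarith
  ultimately have "a * b \<le> exp (b / 4) * (4 * exp (b / 4))"
    using a b by (intro mult_mono) auto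
  also have "\<dots> = 4 * exp (b / 2)"
    by (simp add: exp_add[symmetric])
  finally show ?thesis
    using Mlog_nonneg[OF a] by simp
qed

lemma nn_integral_mult_le_Mlog:
  assumes g: "g \<in> borel_measurable M" and w: "w \<in> borel_measurable M" "\<And>x. 0 \<le> w x"
    and r: "0 < r"
  shows "(\<integral>\<^sup>+x. ennreal (\<bar>g x\<bar> * w x) \<partial>M)
    \<le> ennreal (4 * r) * ((\<integral>\<^sup>+x. ennreal (Mlog (\<bar>g x\<bar> / r)) \<partial>M) + (\<integral>\<^sup>+x. ennreal (exp (w x / 2)) \<partial>M))"
proof -
  have "ennreal (\<bar>g x\<bar> * w x) \<le> ennreal (4 * r) * (ennreal (Mlog (\<bar>g x\<bar> / r)) + ennreal (exp (w x / 2)))"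
    for x
  proof -
    have "\<bar>g x\<bar> * w x = r * ((\<bar>g x\<bar> / r) * w x)"
      using r by simp
    also have "\<dots> \<le> r * (4 * (Mlog (\<bar>g x\<bar> / r) + exp (w x / 2)))"
      using r w(2)[of x] by (intro mult_left_mono mult_le_Mlog_exp) auto
    also have "\<dots> = 4 * r * (Mlog (\<bar>g x\<bar> / r) + exp (w x / 2))"
      by (simp add: mult_ac)
    finally have "ennreal (\<bar>g x\<bar> * w x) \<le> ennreal (4 * r * (Mlog (\<bar>g x\<bar> / r) + exp (w x / 2)))"
      by (rule ennreal_leI)
    also have "\<dots> = ennreal (4 * r) * (ennreal (Mlog (\<bar>g x\<bar> / r)) + ennreal (exp (w x / 2)))"
      using r Mlog_nonneg[of "\<bar>g x\<bar> / r"] by (simp add: ennreal_mult ennreal_plus)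
    finally show ?thesis .
  qed
  then have "(\<integral>\<^sup>+x. ennreal (\<bar>g x\<bar> * w x) \<partial>M)
      \<le> (\<integral>\<^sup>+x. ennreal (4 * r) * (ennreal (Mlog (\<bar>g x\<bar> / r)) + ennreal (exp (w x / 2))) \<partial>M)"
    by (rule nn_integral_mono)
  also have "\<dots> = ennreal (4 * r) * ((\<integral>\<^sup>+x. ennreal (Mlog (\<bar>g x\<bar> / r)) \<partial>M) + (\<integral>\<^sup>+x. ennreal (exp (w x / 2)) \<partial>M))"
  proof -
    have "(\<lambda>x. ennreal (Mlog (\<bar>g x\<bar> / r))) \<in> borel_measurable M"
      using g by measurable
    moreover have "(\<lambda>x. ennreal (exp (w x / 2))) \<in> borel_measurable M"
      using w(1) by measurable
    ultimately show ?thesis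
      by (subst nn_integral_cmult) (auto intro: borel_measurable_add simp: nn_integral_add)
  qed
  finally show ?thesis .
qed

lemma le_cmult_luxemburg_norm:
  assumes c: "0 < c"
    and bound: "\<And>r. 0 < r \<Longrightarrow> (\<integral>\<^sup>+x\<in>\<Omega>. ennreal (M (\<bar>g x\<bar> / r)) \<partial>lebesgue) \<le> 1 \<Longrightarrow> L \<le> ennreal (c * r)"
  shows "L \<le> ennreal c * luxemburg_norm M \<Omega> g"
proof -
  define R where "R = {r::real. 0 < r \<and> (\<integral>\<^sup>+x\<in>\<Omega>. ennreal (M (\<bar>g x\<bar> / r)) \<partial>lebesgue) \<le> 1}"
  show ?thesis
  proof (cases "R = {}")
    case True
    then show ?thesis
      using c by (simp add: luxemburg_norm_def R_def[symmetric] ennreal_mult_top)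
  next
    case False
    have "continuous_on UNIV ((*) (ennreal c))"
      using ennreal_continuous_on_cmult[of "ennreal c" UNIV "\<lambda>x. x"] by (simp add: continuous_on_id)
    then have "ennreal c * Inf (ennreal ` R) = Inf ((*) (ennreal c) ` ennreal ` R)"
      using False
      by (intro continuous_at_Inf_mono continuous_on_imp_continuous_within)
         (auto intro!: monoI mult_left_mono)
    then have "ennreal c * (INF r\<in>R. ennreal r) = (INF r\<in>R. ennreal c * ennreal r)"
      by (simp add: image_image)
    moreover have "L \<le> ennreal c * ennreal r" if "r \<in> R" for r
      using bound[of r] c that by (auto simp: R_def ennreal_mult)
    ultimately show ?thesis
      by (simp add: luxemburg_norm_def R_def[symmetric] le_INF_iff)
  qed
qed

lemma dyadic_shell:
  fixes r :: real
  assumes "0 < r" "r < 1"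
  obtains k where "(1/2) ^ Suc k < r" "r \<le> (1/2) ^ k"
proof -
  obtain n where n: "(1/2::real) ^ n < r"
    using real_arch_pow_inv[OF assms(1), of "1/2"] by auto
  define m where "m = (LEAST n. (1/2::real) ^ n < r)"
  have m: "(1/2::real) ^ m < r"
    unfolding m_def using n by (rule LeastI)
  have "m \<noteq> 0"
    using m assms(2) by (intro notI) simp
  then obtain k where k: "m = Suc k"
    using not0_implies_Suc by blast
  have "\<not> (1/2::real) ^ k < r"
    using not_less_Least[of k "\<lambda>n. (1/2::real) ^ n < r"] by (simp add: m_def[symmetric] k)
  then show ?thesis
    using that m k by simp
qed

lemma power_powr: "0 < x \<Longrightarrow> (x ^ n) powr p = (x powr p) ^ n"
  for x :: real
  by (simp add: powr_powr mult.commute flip: powr_realpow)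

lemma norm_powr_le_dyadic_sum:
  fixes t :: "'a::real_normed_vector" and p :: real
  assumes "0 \<le> p"
  shows "ennreal (norm t powr - p) * indicator (ball 0 1) t
    \<le> (\<Sum>k. ennreal ((2 powr p) ^ Suc k) * indicator (cball 0 ((1/2) ^ k)) t)"
proof (cases "t \<in> ball 0 1 \<and> t \<noteq> 0")
  case True
  let ?F = "\<lambda>j. ennreal ((2 powr p) ^ Suc j) * indicator (cball 0 ((1/2) ^ j)) t"
  obtain k where k1: "(1/2) ^ Suc k < norm t" and k2: "norm t \<le> (1/2) ^ k"
    using True dyadic_shell[of "norm t"] by auto
  have "(1/2::real) powr (- p) = 2 powr p"
    by (simp add: powr_minus powr_divide)
  then have half_powr: "((1/2::real) ^ n) powr - p = (2 powr p) ^ n" for n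
    by (simp add: power_powr)
  have "norm t powr - p \<le> ((1/2) ^ Suc k) powr - p"
    using k1 assms by (intro powr_mono2') auto
  then have "norm t powr - p \<le> (2 powr p) ^ Suc k"
    by (simp only: half_powr)
  then have "ennreal (norm t powr - p) * indicator (ball 0 1) t \<le> ?F k"
    using True k2 by (simp add: ennreal_leI)
  also have "\<dots> \<le> (\<Sum>j. ?F j)"
  proof -
    have "F k \<le> (\<Sum>j. F j)" for F :: "nat \<Rightarrow> ennreal"
      using sum_le_suminf[of F "{k}"] by (simp add: summableI)
    then show ?thesis .
  qed
  finally show ?thesis .
qed auto

lemma nn_integral_ball_norm_powr_finite:
  fixes p :: real
  assumes p: "0 \<le> p" "p < DIM('a)"
  shows "(\<integral>\<^sup>+t\<in>ball (0::'a::euclidean_space) 1. ennreal (norm t powr - p) \<partial>lebesgue) < \<infinity>"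
proof -
  define q where "q = (2::real) powr p"
  define V where "V = unit_ball_vol (real DIM('a))"
  define g where "g k t = ennreal (q ^ Suc k) * indicator (cball (0::'a) ((1/2) ^ k)) t" for k t
  have q: "1 \<le> q"
    using p by (simp add: q_def ge_one_powr_ge_zero)
  have V: "0 \<le> V"
    by (simp add: V_def)
  have int_g: "(\<integral>\<^sup>+t. g k t \<partial>lebesgue) = ennreal (q * V * (q / 2 ^ DIM('a)) ^ k)" for k
  proof -
    have "(\<integral>\<^sup>+t. g k t \<partial>lebesgue) = ennreal (q ^ Suc k) * emeasure lborel (cball (0::'a) ((1/2) ^ k))"
      unfolding g_def by (subst nn_integral_cmult_indicator) auto
    also have "emeasure lborel (cball (0::'a) ((1/2) ^ k)) = ennreal (V * ((1/2) ^ k) ^ DIM('a))"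
      unfolding V_def by (rule emeasure_cball) simp
    also have "ennreal (q ^ Suc k) * ennreal (V * ((1/2) ^ k) ^ DIM('a))
        = ennreal (q ^ Suc k * (V * (1 / 2 ^ DIM('a)) ^ k))"
      using q V by (simp add: ennreal_mult power_one_over[symmetric] power_mult[symmetric] mult.commute)
    also have "q ^ Suc k * (V * (1 / 2 ^ DIM('a)) ^ k) = q * V * (q / 2 ^ DIM('a)) ^ k"
      by (simp add: power_divide power_mult_distrib)
    finally show ?thesis .
  qed
  have "q < 2 ^ DIM('a)"
    using p by (simp add: q_def flip: powr_realpow)
  then have summable: "summable (\<lambda>k. q * V * (q / 2 ^ DIM('a)) ^ k)"
    using q by (intro summable_mult summable_geometric) simp
  have "(\<integral>\<^sup>+t\<in>ball (0::'a) 1. ennreal (norm t powr - p) \<partial>lebesgue) \<le> (\<integral>\<^sup>+t. (\<Sum>k. g k t) \<partial>lebesgue)"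
    unfolding g_def q_def using p(1) by (intro nn_integral_mono norm_powr_le_dyadic_sum)
  also have "\<dots> = (\<Sum>k. ennreal (q * V * (q / 2 ^ DIM('a)) ^ k))"
    unfolding int_g[symmetric] g_def
    by (intro nn_integral_suminf borel_measurable_times_ennreal measurable_const borel_measurable_indicator)
       auto
  also have "\<dots> = ennreal (\<Sum>k. q * V * (q / 2 ^ DIM('a)) ^ k)"
    using summable q V by (intro suminf_ennreal2) auto
  also have "\<dots> < \<infinity>"
    by simp
  finally show ?thesis .
qed

lemma sqrt_one_plus_inverse_le: "0 \<le> x \<Longrightarrow> sqrt (1 + inverse x) \<le> 1 + x powr - (1/2)"
  for x :: real
  using sqrt_add_le_add_sqrt[of 1 "inverse x"]
  by (cases "x = 0") (simp_all add: powr_minus powr_half_sqrt real_sqrt_inverse)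

lemma nn_integral_ball_sqrt_finite:
  "(\<integral>\<^sup>+t\<in>ball (0::'a::euclidean_space) 1. ennreal (sqrt (1 + inverse (norm t))) \<partial>lebesgue) < \<infinity>"
proof -
  have "(\<lambda>t::'a. ennreal (norm t powr - (1/2))) \<in> borel_measurable lebesgue"
    by (intro measurable_completion) measurable
  then have m: "(\<lambda>t::'a. ennreal (norm t powr - (1/2)) * indicator (ball 0 1) t) \<in> borel_measurable lebesgue"
    by (intro borel_measurable_times_ennreal borel_measurable_indicator) simp_all
  have "(\<integral>\<^sup>+t\<in>ball (0::'a) 1. ennreal (sqrt (1 + inverse (norm t))) \<partial>lebesgue)
      \<le> (\<integral>\<^sup>+t. indicator (ball (0::'a) 1) t + ennreal (norm t powr - (1/2)) * indicator (ball 0 1) t \<partial>lebesgue)"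
  proof (intro nn_integral_mono)
    fix t :: 'a
    have "ennreal (sqrt (1 + inverse (norm t))) \<le> ennreal (1 + norm t powr - (1/2))"
      by (intro ennreal_leI sqrt_one_plus_inverse_le) simp
    then show "ennreal (sqrt (1 + inverse (norm t))) * indicator (ball 0 1) t
        \<le> indicator (ball 0 1) t + ennreal (norm t powr - (1/2)) * indicator (ball 0 1) t"
      by (simp add: indicator_def ennreal_plus)
  qed
  also have "\<dots> = emeasure lebesgue (ball (0::'a) 1)
      + (\<integral>\<^sup>+t\<in>ball (0::'a) 1. ennreal (norm t powr - (1/2)) \<partial>lebesgue)"
    using m by (subst nn_integral_add) (auto intro: borel_measurable_indicator)
  also have "\<dots> < \<infinity>"
  proof -
    have "real (Suc 0) \<le> real DIM('a)"
      using DIM_ge_Suc0[where 'a='a] by (simp only: of_nat_le_iff)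
    then have "1/2 < real DIM('a)"
      by linarith
    then have "(\<integral>\<^sup>+t\<in>ball (0::'a) 1. ennreal (norm t powr - (1/2)) \<partial>lebesgue) < \<infinity>"
      by (intro nn_integral_ball_norm_powr_finite) auto
    then show ?thesis
      using emeasure_lborel_ball_finite[of "0::'a" 1] by simp
  qed
  finally show ?thesis .
qed

lemma nn_integral_exterior_log_le:
  fixes f :: "'a::euclidean_space \<Rightarrow> real"
  assumes f: "f \<in> borel_measurable (lebesgue_on (- ball 0 1))" and r: "0 < r"
    and admissible: "(\<integral>\<^sup>+t\<in>ball 0 1. ennreal (Mlog (\<bar>Vop f t\<bar> / r)) \<partial>lebesgue) \<le> 1"
  shows "(\<integral>\<^sup>+s\<in>- ball 0 1. ennreal (\<bar>f s\<bar> * ln (1 + norm s)) \<partial>lebesgue)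
    \<le> ennreal (4 * r) * (1 + (\<integral>\<^sup>+t\<in>ball (0::'a) 1. ennreal (sqrt (1 + inverse (norm t))) \<partial>lebesgue))"
proof -
  let ?w = "\<lambda>t::'a. ln (1 + inverse (norm t))"
  have exp_half_w: "exp (?w t / 2) = sqrt (1 + inverse (norm t))" for t
  proof -
    have "0 < 1 + inverse (norm t)"
      by (simp add: add_pos_nonneg)
    then show ?thesis
      by (simp add: powr_def powr_half_sqrt[symmetric])
  qed
  have ball_sets: "ball (0::'a) 1 \<inter> space lebesgue \<in> sets lebesgue"
    by simp
  have wm: "?w \<in> borel_measurable (lebesgue_on (ball 0 1))"
    by (intro measurable_restrict_space1 measurable_completion) measurable
  have "(\<integral>\<^sup>+s\<in>- ball 0 1. ennreal (\<bar>f s\<bar> * ln (1 + norm s)) \<partial>lebesgue)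
      = (\<integral>\<^sup>+t. ennreal (\<bar>Vop f t\<bar> * ?w t) \<partial>lebesgue_on (ball 0 1))"
    unfolding nn_integral_restrict_space[OF ball_sets]
    by (rule nn_integral_exterior_ball_Vop[OF f]) auto
  also have "\<dots> \<le> ennreal (4 * r) * ((\<integral>\<^sup>+t. ennreal (Mlog (\<bar>Vop f t\<bar> / r)) \<partial>lebesgue_on (ball 0 1))
      + (\<integral>\<^sup>+t. ennreal (exp (?w t / 2)) \<partial>lebesgue_on (ball 0 1)))"
    using borel_measurable_Vop[OF f] wm r
    by (intro nn_integral_mult_le_Mlog) auto
  also have "\<dots> = ennreal (4 * r) * ((\<integral>\<^sup>+t\<in>ball 0 1. ennreal (Mlog (\<bar>Vop f t\<bar> / r)) \<partial>lebesgue)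
      + (\<integral>\<^sup>+t\<in>ball (0::'a) 1. ennreal (sqrt (1 + inverse (norm t))) \<partial>lebesgue))"
    unfolding nn_integral_restrict_space[OF ball_sets] exp_half_w ..
  also have "\<dots> \<le> ennreal (4 * r) * (1 + (\<integral>\<^sup>+t\<in>ball (0::'a) 1. ennreal (sqrt (1 + inverse (norm t))) \<partial>lebesgue))"
    using admissible by (intro mult_left_mono add_right_mono) auto
  finally show ?thesis .
qed

theorem lemmaA3:
  "\<exists>c::real. c > 0 \<and>
     (\<forall>f :: 'a::euclidean_space \<Rightarrow> real.
        f \<in> borel_measurable (lebesgue_on (- ball 0 1)) \<longrightarrow>
        (\<integral>\<^sup>+ s \<in> - ball 0 1. ennreal (\<bar>f s\<bar> * ln (1 + norm s)) \<partial>lebesgue)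
          \<le> ennreal c * luxemburg_norm Mlog (ball 0 1) (Vop f))"
proof -
  obtain K where K: "(\<integral>\<^sup>+t\<in>ball (0::'a) 1. ennreal (sqrt (1 + inverse (norm t))) \<partial>lebesgue) = ennreal K"
    and "0 \<le> K"
    using nn_integral_ball_sqrt_finite[where 'a='a] by (cases rule: ennreal_cases) auto
  have bound: "(\<integral>\<^sup>+s\<in>- ball 0 1. ennreal (\<bar>f s\<bar> * ln (1 + norm s)) \<partial>lebesgue) \<le> ennreal (4 * (1 + K) * r)"
    if "f \<in> borel_measurable (lebesgue_on (- ball 0 1))" "0 < r"
      "(\<integral>\<^sup>+t\<in>ball 0 1. ennreal (Mlog (\<bar>Vop f t\<bar> / r)) \<partial>lebesgue) \<le> 1"
    for f :: "'a \<Rightarrow> real" and r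
  proof -
    have "(\<integral>\<^sup>+s\<in>- ball 0 1. ennreal (\<bar>f s\<bar> * ln (1 + norm s)) \<partial>lebesgue)
        \<le> ennreal (4 * r) * ennreal (1 + K)"
      using nn_integral_exterior_log_le[OF that] K \<open>0 \<le> K\<close> by simp
    also have "\<dots> = ennreal (4 * (1 + K) * r)"
      using \<open>0 \<le> K\<close> \<open>0 < r\<close> by (subst ennreal_mult[symmetric]) (auto simp: mult_ac)
    finally show ?thesis .
  qed
  have "0 < 4 * (1 + K)"
    using \<open>0 \<le> K\<close> by simp
  then show ?thesis
    using bound le_cmult_luxemburg_norm by blast
qed

end
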